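(* Let $N\ge1$, $\mathfrak{g}=\mathfrak{gl}_N(\mathbb{C})$, and let $A$ be a commutative associative unital $\mathbb{C}$-algebra. For every positive integer $k$ and all $b_1,\dots,b_k\in A$, the element $$T_k(b_1,\dots,b_k)=\sum_{(i_1,\dots,i_k)\in\{1,\dots,N\}^k}E_{i_1i_2}(b_1)E_{i_2i_3}(b_2)\cdots E_{i_ki_1}(b_k)\in U(\mathfrak{g}\otimes A)$$ satisfies $[T_k(b_1,\dots,b_k),\mathfrak{g}]=0$, i.e. it commutes in $U(\mathfrak{g}\otimes A)$ with $x\otimes1$ for every $x\in\mathfrak{g}$.
   Context: $\mathfrak{g}\otimes A$ is the Lie algebra with bracket $[x\otimes a,y\otimes b]=[x,y]\otimes ab$, $U(\mathfrak{g}\otimes A)$ is its universal enveloping algebra, and $\mathfrak{g}$ is identified with $\mathfrak{g}\otimes1$. $\{E_{ij}:1\le i,j\le N\}$ is the standard basis of matrix units of $\mathfrak{gl}_N$, with $[E_{ij},E_{kl}]=\delta_{jk}E_{il}-\delta_{il}E_{kj}$, and $E_{ij}(b)=E_{ij}\otimes b$. *)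

theory Defs
  imports "HOL-Analysis.Analysis" "HOL-Library.Poly_Mapping"
begin

section \<open>Complex vector spaces, commutative algebras and Lie algebras as type classes\<close>

class scaleC =
  fixes scaleC :: "complex \<Rightarrow> 'a \<Rightarrow> 'a"  (infixr \<open>*\<^sub>C\<close> 75)

class complex_vector = scaleC + ab_group_add +
  assumes scaleC_add_right: "c *\<^sub>C (x + y) = c *\<^sub>C x + c *\<^sub>C y"
    and scaleC_add_left: "(c + d) *\<^sub>C x = c *\<^sub>C x + d *\<^sub>C x"
    and scaleC_scaleC: "c *\<^sub>C d *\<^sub>C x = (c * d) *\<^sub>C x"
    and scaleC_one: "1 *\<^sub>C x = x"

interpretation complex_vector: vector_space "scaleC :: complex \<Rightarrow> 'a \<Rightarrow> 'a::complex_vector"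
  by unfold_locales (rule scaleC_add_right scaleC_add_left scaleC_scaleC scaleC_one)+

abbreviation clinear :: "('a::complex_vector \<Rightarrow> 'b::complex_vector) \<Rightarrow> bool" where
  "clinear \<equiv> Vector_Spaces.linear scaleC scaleC"

text \<open>The class \<^class>\<open>comm_ring_1\<close> is not used here because it excludes the zero algebra.\<close>

class comm_unital_complex_algebra = complex_vector + comm_ring + comm_monoid_mult +
  assumes scaleC_mult_left: "(c *\<^sub>C x) * y = c *\<^sub>C (x * y)"

class complex_lie_algebra = complex_vector +
  fixes lie :: "'a \<Rightarrow> 'a \<Rightarrow> 'a"
  assumes lie_add_left: "lie (x + y) z = lie x z + lie y z"
    and lie_add_right: "lie x (y + z) = lie x y + lie x z"
    and lie_scaleC_left: "lie (c *\<^sub>C x) y = c *\<^sub>C lie x y"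
    and lie_scaleC_right: "lie x (c *\<^sub>C y) = c *\<^sub>C lie x y"
    and lie_self: "lie x x = 0"
    and lie_jacobi: "lie x (lie y z) + lie y (lie z x) + lie z (lie x y) = 0"

lemma clinearI:
  fixes f :: "'a::complex_vector \<Rightarrow> 'b::complex_vector"
  assumes "\<And>x y. f (x + y) = f x + f y" "\<And>c x. f (c *\<^sub>C x) = c *\<^sub>C f x"
  shows "clinear f"
  by unfold_locales (use assms in auto)

lemma clinear_add: "clinear f \<Longrightarrow> f (x + y) = f x + f y"
  and clinear_scaleC: "clinear f \<Longrightarrow> f (c *\<^sub>C x) = c *\<^sub>C f x"
  and clinear_diff: "clinear f \<Longrightarrow> f (x - y) = f x - f y"
  and clinear_zero: "clinear f \<Longrightarrow> f 0 = 0"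
  by (simp_all add: linear_iff_module_hom module_hom.add module_hom.scale module_hom.diff
      module_hom.zero)

instantiation complex :: complex_vector
begin
definition scaleC_complex :: "complex \<Rightarrow> complex \<Rightarrow> complex" where
  "scaleC_complex c x = c * x"
instance by standard (auto simp: scaleC_complex_def algebra_simps)
end

section \<open>Free vector spaces\<close>

text \<open>The free complex vector space on a set is the type of finitely supported functions
  \<^typ>\<open>'x \<Rightarrow>\<^sub>0 complex\<close>, with basis \<open>Poly_Mapping.single x 1\<close>.\<close>

instantiation poly_mapping :: (type, complex_vector) complex_vector
begin
lift_definition scaleC_poly_mapping :: "complex \<Rightarrow> ('a \<Rightarrow>\<^sub>0 'b) \<Rightarrow> 'a \<Rightarrow>\<^sub>0 'b"
  is "\<lambda>c f k. c *\<^sub>C f k"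
  by (rule finite_subset) auto
instance
  by standard (transfer, simp add: fun_eq_iff complex_vector.vector_space_assms)+
end

lemma lookup_scaleC [simp]: "Poly_Mapping.lookup (c *\<^sub>C p) k = c *\<^sub>C Poly_Mapping.lookup p k"
  by transfer rule

definition free_extend :: "('x \<Rightarrow> 'v::complex_vector) \<Rightarrow> ('x \<Rightarrow>\<^sub>0 complex) \<Rightarrow> 'v" where
  "free_extend f p = (\<Sum>x\<in>Poly_Mapping.keys p. Poly_Mapping.lookup p x *\<^sub>C f x)"

lemma free_extend_superset:
  assumes "finite S" "Poly_Mapping.keys p \<subseteq> S"
  shows "free_extend f p = (\<Sum>x\<in>S. Poly_Mapping.lookup p x *\<^sub>C f x)"
  unfolding free_extend_def
  by (rule sum.mono_neutral_left) (use assms in \<open>auto simp: in_keys_iff\<close>)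

lemma free_extend_single: "free_extend f (Poly_Mapping.single x c) = c *\<^sub>C f x"
  by (subst free_extend_superset[of "{x}"]) (auto split: if_splits)

lemma clinear_free_extend: "clinear (free_extend f)"
proof (rule clinearI)
  fix p q :: "'a \<Rightarrow>\<^sub>0 complex" and c
  let ?S = "Poly_Mapping.keys p \<union> Poly_Mapping.keys q"
  show "free_extend f (p + q) = free_extend f p + free_extend f q"
    by (subst (1 2 3) free_extend_superset[of ?S])
       (use Poly_Mapping.keys_add[of p q] in
         \<open>auto simp: lookup_add scaleC_add_left sum.distrib\<close>)
  show "free_extend f (c *\<^sub>C p) = c *\<^sub>C free_extend f p"
    by (subst (1 2) free_extend_superset[of "Poly_Mapping.keys p"])
       (auto simp: in_keys_iff scaleC_complex_def complex_vector.scale_sum_right scaleC_scaleC)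
qed

section \<open>The tensor product of complex vector spaces\<close>

definition tensor_relators :: "('v::complex_vector \<times> 'w::complex_vector \<Rightarrow>\<^sub>0 complex) set" where
  "tensor_relators =
     {Poly_Mapping.single (x + y, a) 1 - Poly_Mapping.single (x, a) 1
        - Poly_Mapping.single (y, a) 1 | x y a. True} \<union>
     {Poly_Mapping.single (x, a + b) 1 - Poly_Mapping.single (x, a) 1
        - Poly_Mapping.single (x, b) 1 | x a b. True} \<union>
     {Poly_Mapping.single (c *\<^sub>C x, a) 1 - c *\<^sub>C Poly_Mapping.single (x, a) 1 | c x a. True} \<union>
     {Poly_Mapping.single (x, c *\<^sub>C a) 1 - c *\<^sub>C Poly_Mapping.single (x, a) 1 | c x a. True}"

definition tensor_rel ::
    "('v::complex_vector \<times> 'w::complex_vector \<Rightarrow>\<^sub>0 complex) \<Rightarrow> ('v \<times> 'w \<Rightarrow>\<^sub>0 complex) \<Rightarrow> bool" where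
  "tensor_rel p q \<longleftrightarrow> p - q \<in> complex_vector.span tensor_relators"

lemma equivp_span_diff:
  "equivp (\<lambda>p q. p - q \<in> complex_vector.span (S :: 'a::complex_vector set))"
proof (rule equivpI)
  show "reflp (\<lambda>p q. p - q \<in> complex_vector.span S)"
    by (auto intro!: reflpI complex_vector.span_zero)
  show "symp (\<lambda>p q. p - q \<in> complex_vector.span S)"
    by (rule sympI) (metis complex_vector.span_neg minus_diff_eq)
  show "transp (\<lambda>p q. p - q \<in> complex_vector.span S)"
    by (rule transpI) (metis complex_vector.span_add diff_add_cancel add_diff_eq)
qed

quotient_type (overloaded) ('v, 'w) tensor =
    "'v::complex_vector \<times> 'w::complex_vector \<Rightarrow>\<^sub>0 complex" / tensor_rel
  unfolding tensor_rel_def[abs_def] by (rule equivp_span_diff)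

lemma span_diff_add:
  assumes "p - p' \<in> complex_vector.span S" "q - q' \<in> complex_vector.span S"
  shows "(p + q) - (p' + q') \<in> complex_vector.span (S :: 'a::complex_vector set)"
  using complex_vector.span_add[OF assms] by (simp add: algebra_simps)

lemma span_diff_diff:
  assumes "p - p' \<in> complex_vector.span S" "q - q' \<in> complex_vector.span S"
  shows "(p - q) - (p' - q') \<in> complex_vector.span (S :: 'a::complex_vector set)"
  using complex_vector.span_diff[OF assms] by (simp add: algebra_simps)

lemma span_diff_uminus:
  assumes "p - p' \<in> complex_vector.span S"
  shows "(- p) - (- p') \<in> complex_vector.span (S :: 'a::complex_vector set)"
  using complex_vector.span_neg[OF assms] by (simp add: algebra_simps)

lemma span_diff_scaleC:
  assumes "p - p' \<in> complex_vector.span S"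
  shows "c *\<^sub>C p - c *\<^sub>C p' \<in> complex_vector.span (S :: 'a::complex_vector set)"
  using complex_vector.span_scale[OF assms, of c]
  by (simp add: complex_vector.scale_right_diff_distrib)

instantiation tensor :: (complex_vector, complex_vector) complex_vector
begin
lift_definition zero_tensor :: "('a, 'b) tensor" is 0 .
lift_definition plus_tensor :: "('a, 'b) tensor \<Rightarrow> ('a, 'b) tensor \<Rightarrow> ('a, 'b) tensor" is "(+)"
  unfolding tensor_rel_def by (rule span_diff_add)
lift_definition minus_tensor :: "('a, 'b) tensor \<Rightarrow> ('a, 'b) tensor \<Rightarrow> ('a, 'b) tensor" is "(-)"
  unfolding tensor_rel_def by (rule span_diff_diff)
lift_definition uminus_tensor :: "('a, 'b) tensor \<Rightarrow> ('a, 'b) tensor" is uminus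
  unfolding tensor_rel_def by (rule span_diff_uminus)
lift_definition scaleC_tensor :: "complex \<Rightarrow> ('a, 'b) tensor \<Rightarrow> ('a, 'b) tensor" is scaleC
  unfolding tensor_rel_def by (rule span_diff_scaleC)
instance
  by standard
     (transfer; simp add: tensor_rel_def complex_vector.span_zero complex_vector.vector_space_assms
        algebra_simps)+
end

lift_definition pure_tensor :: "'v::complex_vector \<Rightarrow> 'w::complex_vector \<Rightarrow> ('v, 'w) tensor"
    (infixl \<open>\<otimes>\<^sub>C\<close> 76)
  is "\<lambda>x a. Poly_Mapping.single (x, a) 1" .

lemma pure_tensor_add_left: "(x + y) \<otimes>\<^sub>C a = x \<otimes>\<^sub>C a + y \<otimes>\<^sub>C a"
  by transfer
     (unfold tensor_rel_def tensor_relators_def diff_diff_eq[symmetric],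
      rule complex_vector.span_base, blast)

lemma pure_tensor_add_right: "x \<otimes>\<^sub>C (a + b) = x \<otimes>\<^sub>C a + x \<otimes>\<^sub>C b"
  by transfer
     (unfold tensor_rel_def tensor_relators_def diff_diff_eq[symmetric],
      rule complex_vector.span_base, blast)

lemma pure_tensor_scaleC_left: "(c *\<^sub>C x) \<otimes>\<^sub>C a = c *\<^sub>C (x \<otimes>\<^sub>C a)"
  by transfer
     (unfold tensor_rel_def tensor_relators_def, rule complex_vector.span_base, blast)

lemma pure_tensor_scaleC_right: "x \<otimes>\<^sub>C (c *\<^sub>C a) = c *\<^sub>C (x \<otimes>\<^sub>C a)"
  by transfer
     (unfold tensor_rel_def tensor_relators_def, rule complex_vector.span_base, blast)

lemma free_vector_induct [case_names zero add scale single]: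
  fixes p :: "'x \<Rightarrow>\<^sub>0 complex"
  assumes zero: "P 0" and add: "\<And>p q. P p \<Longrightarrow> P q \<Longrightarrow> P (p + q)"
    and scale: "\<And>c p. P p \<Longrightarrow> P (c *\<^sub>C p)" and single: "\<And>x. P (Poly_Mapping.single x 1)"
  shows "P p"
proof -
  have eq: "p = (\<Sum>x\<in>Poly_Mapping.keys p. Poly_Mapping.lookup p x *\<^sub>C Poly_Mapping.single x 1)"
    by (rule poly_mapping_eqI)
       (auto simp: lookup_sum lookup_single scaleC_complex_def when_def in_keys_iff sum.delta'
          if_distrib cong: if_cong)
  have "P (\<Sum>x\<in>S. Poly_Mapping.lookup p x *\<^sub>C Poly_Mapping.single x 1)" if "finite S" for S
    using that by induction (auto intro: assms)
  then show ?thesis using eq by (metis finite_keys)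
qed

lemma tensor_induct [case_names zero add pure]:
  assumes zero: "P 0" and add: "\<And>s t. P s \<Longrightarrow> P t \<Longrightarrow> P (s + t)"
    and pure: "\<And>x a. P (x \<otimes>\<^sub>C a)"
  shows "P (t :: ('v::complex_vector, 'w::complex_vector) tensor)"
proof -
  have "\<forall>c. P (c *\<^sub>C abs_tensor p)" for p :: "'v \<times> 'w \<Rightarrow>\<^sub>0 complex"
  proof (induction p rule: free_vector_induct)
    case zero
    then show ?case by (simp add: assms(1) flip: zero_tensor_def)
  next
    case (add p q)
    then show ?case by (simp add: assms(2) scaleC_add_right flip: plus_tensor.abs_eq)
  next
    case (scale c p)
    then show ?case by (simp add: scaleC_scaleC flip: scaleC_tensor.abs_eq)
  next
    case (single z)
    obtain x a where z: "z = (x, a)" by (cases z)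
    have "c *\<^sub>C abs_tensor (Poly_Mapping.single z 1) = (c *\<^sub>C x) \<otimes>\<^sub>C a" for c
      by (metis z pure_tensor_scaleC_left pure_tensor.abs_eq)
    then show ?case by (simp add: pure)
  qed
  then have "P (1 *\<^sub>C abs_tensor (rep_tensor t))" by blast
  then show ?thesis
    by (simp add: scaleC_one Quotient_abs_rep[OF Quotient_tensor])
qed

definition cbilinear :: "('u::complex_vector \<Rightarrow> 'v::complex_vector \<Rightarrow> 'w::complex_vector) \<Rightarrow> bool" where
  "cbilinear f \<longleftrightarrow> (\<forall>x. clinear (f x)) \<and> (\<forall>a. clinear (\<lambda>x. f x a))"

text \<open>Universal property of the tensor product.\<close>

definition tensor_lift ::
    "('u::complex_vector \<Rightarrow> 'v::complex_vector \<Rightarrow> 'w::complex_vector) \<Rightarrow> ('u, 'v) tensor \<Rightarrow> 'w" where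
  "tensor_lift f t = free_extend (\<lambda>(x, a). f x a) (rep_tensor t)"

lemma tensor_lift_abs:
  assumes f: "cbilinear f"
  shows "tensor_lift f (abs_tensor p) = free_extend (\<lambda>(x, a). f x a) p"
proof -
  let ?F = "free_extend (\<lambda>(x, a). f x a)"
  note F = clinear_free_extend[of "\<lambda>(x, a). f x a"]
  have rel: "?F r = 0" if "r \<in> complex_vector.span tensor_relators" for r
    using that
  proof (induction rule: complex_vector.span_induct_alt)
    case base
    show ?case by (rule clinear_zero[OF F])
  next
    case (step c r s)
    have "?F r = 0"
      using step.hyps(1) f unfolding tensor_relators_def cbilinear_def
      by (auto simp: clinear_diff[OF F] clinear_scaleC[OF F] free_extend_single scaleC_one
          clinear_add clinear_scaleC clinear_add[of "\<lambda>x. f x a" for a]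
          clinear_scaleC[of "\<lambda>x. f x a" for a])
    then show ?case
      using step.IH by (simp add: clinear_add[OF F] clinear_scaleC[OF F])
  qed
  have "tensor_rel (rep_tensor (abs_tensor p)) p"
    using Quotient3_rep_abs[OF Quotient3_tensor, of p]
    by (simp add: tensor_rel_def complex_vector.span_zero)
  then show ?thesis
    using rel clinear_diff[OF F] unfolding tensor_lift_def tensor_rel_def
    by (metis eq_iff_diff_eq_0)
qed

lemma tensor_lift_pure: "cbilinear f \<Longrightarrow> tensor_lift f (x \<otimes>\<^sub>C a) = f x a"
  by (simp add: pure_tensor.abs_eq tensor_lift_abs free_extend_single scaleC_one)

lemma clinear_tensor_lift:
  assumes "cbilinear f" shows "clinear (tensor_lift f)"
proof (rule clinearI)
  fix s t :: "('a, 'b) tensor" and c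
  obtain p q where s: "s = abs_tensor p" and t: "t = abs_tensor q"
    by (metis Quotient_abs_rep[OF Quotient_tensor])
  show "tensor_lift f (s + t) = tensor_lift f s + tensor_lift f t"
    by (simp add: s t plus_tensor.abs_eq tensor_lift_abs assms clinear_add[OF clinear_free_extend])
  show "tensor_lift f (c *\<^sub>C s) = c *\<^sub>C tensor_lift f s"
    by (simp add: s scaleC_tensor.abs_eq tensor_lift_abs assms
        clinear_scaleC[OF clinear_free_extend])
qed

section \<open>The Lie algebra \<open>L \<otimes> A\<close>\<close>

instantiation tensor :: (complex_lie_algebra, comm_unital_complex_algebra) complex_lie_algebra
begin

definition lie_tensor :: "('a, 'b) tensor \<Rightarrow> ('a, 'b) tensor \<Rightarrow> ('a, 'b) tensor" where
  "lie_tensor s t = tensor_lift (\<lambda>x a. tensor_lift (\<lambda>y b. lie x y \<otimes>\<^sub>C (a * b)) t) s"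

lemma scaleC_mult_right: "x * (c *\<^sub>C y) = c *\<^sub>C (x * (y :: 'c::comm_unital_complex_algebra))"
  by (metis mult.commute scaleC_mult_left)

lemma lie_tensor_aux:
  shows cbilinear_inner:
      "cbilinear (\<lambda>y b. lie x y \<otimes>\<^sub>C (a * b) :: ('a, 'b) tensor)" (is ?A)
    and cbilinear_outer:
      "cbilinear (\<lambda>x a. tensor_lift (\<lambda>y b. lie x y \<otimes>\<^sub>C (a * b)) (t :: ('a, 'b) tensor))" (is ?B)
proof -
  show inner: "cbilinear (\<lambda>y b. lie x y \<otimes>\<^sub>C (a * b) :: ('a, 'b) tensor)" for x a
    unfolding cbilinear_def
    by (auto intro!: clinearI simp: pure_tensor_add_left pure_tensor_add_right
        pure_tensor_scaleC_left pure_tensor_scaleC_right lie_add_right lie_scaleC_right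
        distrib_left scaleC_mult_right)
  define g where "g x a = tensor_lift (\<lambda>y b. lie x y \<otimes>\<^sub>C (a * b) :: ('a, 'b) tensor)" for x a
  have g: "clinear (g x a)" for x a
    unfolding g_def by (rule clinear_tensor_lift[OF inner])
  have g_pure: "g x a (y \<otimes>\<^sub>C b) = lie x y \<otimes>\<^sub>C (a * b)" for x a y b
    unfolding g_def by (rule tensor_lift_pure[OF inner])
  have 1: "g x (a + a') t = g x a t + g x a' t" for x a a'
    by (induction t rule: tensor_induct)
       (simp_all add: clinear_zero[OF g] clinear_add[OF g] g_pure distrib_right
         pure_tensor_add_right)
  have 2: "g (x + x') a t = g x a t + g x' a t" for x x' a
    by (induction t rule: tensor_induct)
       (simp_all add: clinear_zero[OF g] clinear_add[OF g] g_pure lie_add_left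
         pure_tensor_add_left)
  have 3: "g x (c *\<^sub>C a) t = c *\<^sub>C g x a t" for x a c
    by (induction t rule: tensor_induct)
       (simp_all add: clinear_zero[OF g] clinear_add[OF g] g_pure scaleC_mult_left
         pure_tensor_scaleC_right scaleC_add_right)
  have 4: "g (c *\<^sub>C x) a t = c *\<^sub>C g x a t" for x a c
    by (induction t rule: tensor_induct)
       (simp_all add: clinear_zero[OF g] clinear_add[OF g] g_pure lie_scaleC_left
         pure_tensor_scaleC_left scaleC_add_right)
  have "cbilinear (\<lambda>x a. g x a t)"
    unfolding cbilinear_def by (intro conjI allI clinearI 1 2 3 4)
  then show ?B
    by (simp only: g_def)
qed

lemma lie_pure_tensor_left:
  "lie (x \<otimes>\<^sub>C a) (t :: ('a, 'b) tensor) = tensor_lift (\<lambda>y b. lie x y \<otimes>\<^sub>C (a * b)) t"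
  unfolding lie_tensor_def by (rule tensor_lift_pure[OF cbilinear_outer])

lemma lie_pure_tensor: "lie (x \<otimes>\<^sub>C a) (y \<otimes>\<^sub>C b) = (lie x y \<otimes>\<^sub>C (a * b) :: ('a, 'b) tensor)"
  by (simp add: lie_pure_tensor_left tensor_lift_pure[OF cbilinear_inner])

instance
proof
  fix x y z :: "('a, 'b) tensor" and c
  have left: "clinear (\<lambda>s. lie s t)" for t :: "('a, 'b) tensor"
    unfolding lie_tensor_def by (rule clinear_tensor_lift[OF cbilinear_outer])
  have right: "lie s (t + u) = lie s t + lie s u \<and> lie s (c *\<^sub>C t) = c *\<^sub>C lie s t"
    for s t u :: "('a, 'b) tensor" and c
  proof (induction s rule: tensor_induct)
    case zero
    then show ?case by (simp add: clinear_zero[OF left])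
  next
    case (add s s')
    then show ?case by (simp add: clinear_add[OF left] scaleC_add_right)
  next
    case (pure x a)
    then show ?case
      by (simp add: lie_pure_tensor_left
          clinear_add[OF clinear_tensor_lift[OF cbilinear_inner]]
          clinear_scaleC[OF clinear_tensor_lift[OF cbilinear_inner]])
  qed
  have add_l: "lie (s + t) u = lie s u + lie t u" for s t u :: "('a, 'b) tensor"
    by (rule clinear_add[OF left])
  have add_r: "lie s (t + u) = lie s t + lie s u" for s t u :: "('a, 'b) tensor"
    using right by blast
  have zero_l: "lie 0 u = 0" for u :: "('a, 'b) tensor"
    by (rule clinear_zero[OF left])
  have zero_r: "lie u 0 = 0" for u :: "('a, 'b) tensor"
    by (metis add_r add_cancel_right_right add.right_neutral)
  show "lie (x + y) z = lie x z + lie y z" "lie x (y + z) = lie x y + lie x z"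
    by (fact add_l add_r)+
  show "lie (c *\<^sub>C x) y = c *\<^sub>C lie x y"
    by (rule clinear_scaleC[OF left])
  show "lie x (c *\<^sub>C y) = c *\<^sub>C lie x y"
    using right by blast
  have anti0: "lie u v = - lie v u" for u v :: 'a
  proof -
    have "lie u v + lie v u = lie (u + v) (u + v)"
      by (simp only: lie_add_left lie_add_right lie_self[of u] lie_self[of v] add_0_left
          add_0_right add.commute)
    then have "lie u v + lie v u = 0" by (simp only: lie_self)
    then show ?thesis by (simp add: eq_neg_iff_add_eq_0)
  qed
  have neg_pure: "(- u) \<otimes>\<^sub>C d = - (u \<otimes>\<^sub>C d)" for u :: 'a and d :: 'b
    by (metis complex_vector.scale_minus_left pure_tensor_scaleC_left scaleC_one)
  have zero_pure: "0 \<otimes>\<^sub>C d = (0 :: ('a, 'b) tensor)" for d :: 'b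
    by (metis complex_vector.scale_zero_left pure_tensor_scaleC_left)
  have anti_pure: "lie (u \<otimes>\<^sub>C d) t = - lie t (u \<otimes>\<^sub>C d)" for u d and t :: "('a, 'b) tensor"
  proof (induction t rule: tensor_induct)
    case (pure v e)
    then show ?case
      by (simp add: lie_pure_tensor anti0[of v u] neg_pure mult.commute)
  qed (simp_all add: zero_l zero_r add_l add_r)
  have anti: "lie s t = - lie t s" for s t :: "('a, 'b) tensor"
    by (induction s rule: tensor_induct) (simp_all add: zero_l zero_r add_l add_r anti_pure)
  show "lie x x = 0"
  proof (induction x rule: tensor_induct)
    case (add s t)
    then show ?case by (simp add: add_l add_r anti[of s t])
  qed (simp_all add: zero_l lie_pure_tensor lie_self zero_pure)
  have jac_pure: "lie (u \<otimes>\<^sub>C d) (lie (v \<otimes>\<^sub>C e) (w \<otimes>\<^sub>C f)) + lie (v \<otimes>\<^sub>C e) (lie (w \<otimes>\<^sub>C f) (u \<otimes>\<^sub>C d))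
      + lie (w \<otimes>\<^sub>C f) (lie (u \<otimes>\<^sub>C d) (v \<otimes>\<^sub>C e)) = (0 :: ('a, 'b) tensor)" for u v w d e f
  proof -
    have "e * (f * d) = d * (e * f)" "f * (d * e) = d * (e * f)"
      by (simp_all add: ac_simps)
    then show ?thesis
      by (simp add: lie_pure_tensor lie_jacobi zero_pure flip: pure_tensor_add_left)
  qed
  have jac2: "lie (u \<otimes>\<^sub>C d) (lie (v \<otimes>\<^sub>C e) t) + lie (v \<otimes>\<^sub>C e) (lie t (u \<otimes>\<^sub>C d))
      + lie t (lie (u \<otimes>\<^sub>C d) (v \<otimes>\<^sub>C e)) = 0" for u v d e and t :: "('a, 'b) tensor"
  proof (induction t rule: tensor_induct)
    case (add s t)
    have "lie (u \<otimes>\<^sub>C d) (lie (v \<otimes>\<^sub>C e) (s + t)) + lie (v \<otimes>\<^sub>C e) (lie (s + t) (u \<otimes>\<^sub>C d))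
        + lie (s + t) (lie (u \<otimes>\<^sub>C d) (v \<otimes>\<^sub>C e))
      = (lie (u \<otimes>\<^sub>C d) (lie (v \<otimes>\<^sub>C e) s) + lie (v \<otimes>\<^sub>C e) (lie s (u \<otimes>\<^sub>C d))
          + lie s (lie (u \<otimes>\<^sub>C d) (v \<otimes>\<^sub>C e)))
        + (lie (u \<otimes>\<^sub>C d) (lie (v \<otimes>\<^sub>C e) t) + lie (v \<otimes>\<^sub>C e) (lie t (u \<otimes>\<^sub>C d))
          + lie t (lie (u \<otimes>\<^sub>C d) (v \<otimes>\<^sub>C e)))"
      by (simp only: add_l add_r ac_simps)
    then show ?case using add by simp
  qed (simp_all add: zero_l zero_r jac_pure)
  have jac1: "lie (u \<otimes>\<^sub>C d) (lie s t) + lie s (lie t (u \<otimes>\<^sub>C d)) + lie t (lie (u \<otimes>\<^sub>C d) s) = 0"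
    for u d and s t :: "('a, 'b) tensor"
  proof (induction s rule: tensor_induct)
    case (add r s)
    have "lie (u \<otimes>\<^sub>C d) (lie (r + s) t) + lie (r + s) (lie t (u \<otimes>\<^sub>C d)) + lie t (lie (u \<otimes>\<^sub>C d) (r + s))
      = (lie (u \<otimes>\<^sub>C d) (lie r t) + lie r (lie t (u \<otimes>\<^sub>C d)) + lie t (lie (u \<otimes>\<^sub>C d) r))
        + (lie (u \<otimes>\<^sub>C d) (lie s t) + lie s (lie t (u \<otimes>\<^sub>C d)) + lie t (lie (u \<otimes>\<^sub>C d) s))"
      by (simp only: add_l add_r ac_simps)
    then show ?case using add by simp
  qed (simp_all add: zero_l zero_r jac2)
  show "lie x (lie y z) + lie y (lie z x) + lie z (lie x y) = 0"
  proof (induction x rule: tensor_induct)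
    case (add r s)
    have "lie (r + s) (lie y z) + lie y (lie z (r + s)) + lie z (lie (r + s) y)
      = (lie r (lie y z) + lie y (lie z r) + lie z (lie r y))
        + (lie s (lie y z) + lie y (lie z s) + lie z (lie s y))"
      by (simp only: add_l add_r ac_simps)
    then show ?case using add by simp
  qed (simp_all add: zero_l zero_r jac1)
qed

end

section \<open>The universal enveloping algebra\<close>

text \<open>Lists over \<open>'x\<close> are the free monoid on \<open>'x\<close>, written additively so that
  \<^typ>\<open>'x list \<Rightarrow>\<^sub>0 complex\<close>, with the convolution product of \<^typ>\<open>'k \<Rightarrow>\<^sub>0 complex\<close>, is the
  free associative unital algebra on \<open>'x\<close>.\<close>

instantiation list :: (type) monoid_add
begin
definition zero_list :: "'a list" where "zero_list = []"
definition plus_list :: "'a list \<Rightarrow> 'a list \<Rightarrow> 'a list" where "plus_list xs ys = xs @ ys"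
instance by standard (auto simp: zero_list_def plus_list_def)
end

abbreviation free_gen :: "'x \<Rightarrow> 'x list \<Rightarrow>\<^sub>0 complex" where
  "free_gen x \<equiv> Poly_Mapping.single [x] 1"

text \<open>The first two families turn the free algebra on the underlying set of \<open>L\<close> into the tensor
  algebra of the vector space \<open>L\<close>.\<close>

definition uea_relators :: "('l::complex_lie_algebra list \<Rightarrow>\<^sub>0 complex) set" where
  "uea_relators =
     {free_gen (x + y) - free_gen x - free_gen y | x y. True} \<union>
     {free_gen (c *\<^sub>C x) - c *\<^sub>C free_gen x | c x. True} \<union>
     {free_gen x * free_gen y - free_gen y * free_gen x - free_gen (lie x y) | x y. True}"

text \<open>The two-sided ideal generated by the relators.\<close>

definition uea_ideal :: "('l::complex_lie_algebra list \<Rightarrow>\<^sub>0 complex) set" where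
  "uea_ideal = complex_vector.span {p * r * q | p r q. r \<in> uea_relators}"

definition uea_rel ::
    "('l::complex_lie_algebra list \<Rightarrow>\<^sub>0 complex) \<Rightarrow> ('l list \<Rightarrow>\<^sub>0 complex) \<Rightarrow> bool" where
  "uea_rel p q \<longleftrightarrow> p - q \<in> uea_ideal"

quotient_type (overloaded) 'l uea = "'l::complex_lie_algebra list \<Rightarrow>\<^sub>0 complex" / uea_rel
  unfolding uea_rel_def[abs_def] uea_ideal_def by (rule equivp_span_diff)

lemma uea_rel_eqI: "p = q \<Longrightarrow> uea_rel p q"
  by (simp add: uea_rel_def uea_ideal_def complex_vector.span_zero)

lemma scaleC_conv_mult: "c *\<^sub>C p = Poly_Mapping.single 0 c * (p :: 'k::monoid_add \<Rightarrow>\<^sub>0 complex)"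
proof -
  have "c *\<^sub>C p = Poly_Mapping.map (\<lambda>x. c * x) p"
    by (rule poly_mapping_eqI) (simp add: Poly_Mapping.map.rep_eq scaleC_complex_def when_def)
  then show ?thesis by (simp add: mult_map_scale_conv_mult)
qed

lemma free_scaleC_mult_left: "(c *\<^sub>C p) * q = c *\<^sub>C (p * q :: 'k::monoid_add \<Rightarrow>\<^sub>0 complex)"
  by (simp add: scaleC_conv_mult mult.assoc)

lemma free_scaleC_mult_right: "p * (c *\<^sub>C q) = c *\<^sub>C (p * q :: 'k::monoid_add \<Rightarrow>\<^sub>0 complex)"
proof -
  have "p * Poly_Mapping.single 0 c = Poly_Mapping.single 0 c * p"
    by (induction p rule: free_vector_induct)
       (simp_all add: distrib_left distrib_right free_scaleC_mult_left mult_single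
         scaleC_conv_mult[symmetric] scaleC_add_right complex_vector.scale_left_commute)
  then show ?thesis by (simp add: scaleC_conv_mult mult.assoc[symmetric])
qed

lemma uea_ideal_mult_left: "r \<in> uea_ideal \<Longrightarrow> p * r \<in> uea_ideal"
  unfolding uea_ideal_def
proof (induction rule: complex_vector.span_induct_alt)
  case base
  show ?case by (simp add: complex_vector.span_zero)
next
  case (step c x y)
  have "p * x \<in> {p * r * q | p r q. r \<in> uea_relators}"
    using step.hyps(1) by (force simp: mult.assoc[symmetric])
  with step.IH show ?case
    by (simp add: distrib_left free_scaleC_mult_right complex_vector.span_add
        complex_vector.span_scale complex_vector.span_base)
qed

lemma uea_ideal_mult_right: "r \<in> uea_ideal \<Longrightarrow> r * p \<in> uea_ideal"
  unfolding uea_ideal_def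
proof (induction rule: complex_vector.span_induct_alt)
  case base
  show ?case by (simp add: complex_vector.span_zero)
next
  case (step c x y)
  have "x * p \<in> {p * r * q | p r q. r \<in> uea_relators}"
    using step.hyps(1) by (force simp: mult.assoc)
  with step.IH show ?case
    by (simp add: distrib_right free_scaleC_mult_left complex_vector.span_add
        complex_vector.span_scale complex_vector.span_base)
qed

lemma lookup_Nil_mult:
  "Poly_Mapping.lookup (p * q) [] =
     Poly_Mapping.lookup p [] * Poly_Mapping.lookup (q :: 'x list \<Rightarrow>\<^sub>0 complex) []"
proof (induction p rule: free_vector_induct)
  case (single xs)
  show ?case
    by (induction q rule: free_vector_induct)
       (simp_all add: distrib_left lookup_add free_scaleC_mult_right mult_single lookup_single
         plus_list_def scaleC_complex_def when_def)
qed (simp_all add: distrib_right lookup_add free_scaleC_mult_left scaleC_complex_def)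

lemma lookup_Nil_uea_ideal: "r \<in> uea_ideal \<Longrightarrow> Poly_Mapping.lookup r [] = 0"
  unfolding uea_ideal_def
proof (induction rule: complex_vector.span_induct_alt)
  case (step c x y)
  then show ?case
    by (auto simp: lookup_add lookup_Nil_mult uea_relators_def lookup_minus lookup_single
        scaleC_complex_def)
qed simp

lemma lookup_Nil_one: "Poly_Mapping.lookup (1 :: 'x list \<Rightarrow>\<^sub>0 complex) [] = 1"
  by (simp add: lookup_one zero_list_def)

instantiation uea :: (complex_lie_algebra) "{complex_vector, ring_1}"
begin
lift_definition zero_uea :: "'a uea" is 0 .
lift_definition one_uea :: "'a uea" is 1 .
lift_definition plus_uea :: "'a uea \<Rightarrow> 'a uea \<Rightarrow> 'a uea" is "(+)"
  unfolding uea_rel_def uea_ideal_def by (rule span_diff_add)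
lift_definition minus_uea :: "'a uea \<Rightarrow> 'a uea \<Rightarrow> 'a uea" is "(-)"
  unfolding uea_rel_def uea_ideal_def by (rule span_diff_diff)
lift_definition uminus_uea :: "'a uea \<Rightarrow> 'a uea" is uminus
  unfolding uea_rel_def uea_ideal_def by (rule span_diff_uminus)
lift_definition scaleC_uea :: "complex \<Rightarrow> 'a uea \<Rightarrow> 'a uea" is scaleC
  unfolding uea_rel_def uea_ideal_def by (rule span_diff_scaleC)
lift_definition times_uea :: "'a uea \<Rightarrow> 'a uea \<Rightarrow> 'a uea" is times
proof -
  fix p p' q q' :: "'a list \<Rightarrow>\<^sub>0 complex"
  assume "uea_rel p p'" "uea_rel q q'"
  then have "(p - p') * q \<in> uea_ideal" "p' * (q - q') \<in> uea_ideal"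
    unfolding uea_rel_def by (simp_all only: uea_ideal_mult_right uea_ideal_mult_left)
  then have "(p - p') * q + p' * (q - q') \<in> uea_ideal"
    unfolding uea_ideal_def by (rule complex_vector.span_add)
  moreover have "(p - p') * q + p' * (q - q') = p * q - p' * q'"
    by (simp only: left_diff_distrib right_diff_distrib diff_add_eq_diff_diff_swap) simp
  ultimately show "uea_rel (p * q) (p' * q')"
    by (simp only: uea_rel_def)
qed
instance
proof
  show "(0 :: 'a uea) \<noteq> 1"
  proof (transfer, rule notI)
    assume "uea_rel (0 :: 'a list \<Rightarrow>\<^sub>0 complex) 1"
    then have "Poly_Mapping.lookup (0 - 1 :: 'a list \<Rightarrow>\<^sub>0 complex) [] = 0"
      unfolding uea_rel_def by (rule lookup_Nil_uea_ideal)
    then show False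
      by (simp add: lookup_minus lookup_Nil_one)
  qed
  fix x y z :: "'a uea" and c d
  show "x * y * z = x * (y * z)" by (transfer, rule uea_rel_eqI, rule mult.assoc)
  show "x + y + z = x + (y + z)" by (transfer, rule uea_rel_eqI, rule add.assoc)
  show "x + y = y + x" by (transfer, rule uea_rel_eqI, rule add.commute)
  show "0 + x = x" by (transfer, rule uea_rel_eqI, rule add_0_left)
  show "- x + x = 0" by (transfer, rule uea_rel_eqI, rule left_minus)
  show "x - y = x + - y" by (transfer, rule uea_rel_eqI, rule diff_conv_add_uminus)
  show "1 * x = x" by (transfer, rule uea_rel_eqI, rule mult_1_left)
  show "x * 1 = x" by (transfer, rule uea_rel_eqI, rule mult_1_right)
  show "(x + y) * z = x * z + y * z" by (transfer, rule uea_rel_eqI, rule distrib_right)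
  show "x * (y + z) = x * y + x * z" by (transfer, rule uea_rel_eqI, rule distrib_left)
  show "c *\<^sub>C (x + y) = c *\<^sub>C x + c *\<^sub>C y" by (transfer, rule uea_rel_eqI, rule scaleC_add_right)
  show "(c + d) *\<^sub>C x = c *\<^sub>C x + d *\<^sub>C x" by (transfer, rule uea_rel_eqI, rule scaleC_add_left)
  show "c *\<^sub>C d *\<^sub>C x = (c * d) *\<^sub>C x" by (transfer, rule uea_rel_eqI, rule scaleC_scaleC)
  show "1 *\<^sub>C x = x" by (transfer, rule uea_rel_eqI, rule scaleC_one)
qed
end

lemma uea_scaleC_mult_left: "(c *\<^sub>C u) * v = c *\<^sub>C (u * v :: 'l::complex_lie_algebra uea)"
  by transfer (simp add: free_scaleC_mult_left uea_rel_def uea_ideal_def complex_vector.span_zero)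

lemma uea_scaleC_mult_right: "u * (c *\<^sub>C v) = c *\<^sub>C (u * v :: 'l::complex_lie_algebra uea)"
  by transfer (simp add: free_scaleC_mult_right uea_rel_def uea_ideal_def complex_vector.span_zero)

text \<open>The canonical map from a Lie algebra to its universal enveloping algebra.\<close>

lift_definition uea_of :: "'l::complex_lie_algebra \<Rightarrow> 'l uea" is free_gen .

lemma uea_relators_subset_ideal: "r \<in> uea_relators \<Longrightarrow> r \<in> uea_ideal"
  unfolding uea_ideal_def by (rule complex_vector.span_base) (metis (mono_tags, lifting)
      mem_Collect_eq mult_1 mult_1_right)

lemma uea_of_add: "uea_of (x + y) = uea_of x + uea_of y"
  by transfer
     (unfold uea_rel_def diff_diff_eq[symmetric], rule uea_relators_subset_ideal,
      unfold uea_relators_def, blast)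

lemma uea_of_scaleC: "uea_of (c *\<^sub>C x) = c *\<^sub>C uea_of x"
  by transfer
     (unfold uea_rel_def, rule uea_relators_subset_ideal, unfold uea_relators_def, blast)

lemma uea_of_lie: "uea_of x * uea_of y - uea_of y * uea_of x = uea_of (lie x y)"
  by transfer
     (unfold uea_rel_def, rule uea_relators_subset_ideal, unfold uea_relators_def, blast)

section \<open>The Lie algebra \<open>gl\<^sub>N\<close>\<close>

text \<open>The index set \<open>{1, \<dots>, N}\<close> is rendered by a finite type \<open>'n\<close>, with \<open>N = CARD('n)\<close>.  A copy
  of the matrix type is used so that it can be made an instance of \<^class>\<open>complex_lie_algebra\<close>.\<close>

typedef ('n::finite) gl = "UNIV :: (complex ^ 'n ^ 'n) set"
  morphisms mat_of_gl gl_of_mat ..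

setup_lifting type_definition_gl

instantiation gl :: (finite) complex_lie_algebra
begin
lift_definition zero_gl :: "'a gl" is 0 .
lift_definition plus_gl :: "'a gl \<Rightarrow> 'a gl \<Rightarrow> 'a gl" is "(+)" .
lift_definition minus_gl :: "'a gl \<Rightarrow> 'a gl \<Rightarrow> 'a gl" is "(-)" .
lift_definition uminus_gl :: "'a gl \<Rightarrow> 'a gl" is uminus .
lift_definition scaleC_gl :: "complex \<Rightarrow> 'a gl \<Rightarrow> 'a gl" is "\<lambda>c X. \<chi> i j. c * X $ i $ j" .
lift_definition lie_gl :: "'a gl \<Rightarrow> 'a gl \<Rightarrow> 'a gl" is "\<lambda>X Y. X ** Y - Y ** X" .
instance
proof
  have sub_l: "(X - Y) ** Z = X ** Z - Y ** Z" and sub_r: "Z ** (X - Y) = Z ** X - Z ** Y"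
    for X Y Z :: "complex ^ 'a ^ 'a"
    by (simp_all add: matrix_matrix_mult_def vec_eq_iff left_diff_distrib right_diff_distrib
        sum_subtractf)
  have add_l: "(X + Y) ** Z = X ** Z + Y ** Z" for X Y Z :: "complex ^ 'a ^ 'a"
    by (simp add: matrix_matrix_mult_def vec_eq_iff distrib_right sum.distrib)
  fix x y z :: "'a gl" and c d
  show "lie (x + y) z = lie x z + lie y z" "lie x (y + z) = lie x y + lie x z"
    by (transfer, simp add: matrix_add_ldistrib add_l)+
  show "lie x x = 0" by transfer simp
  show "lie x (lie y z) + lie y (lie z x) + lie z (lie x y) = 0"
    by transfer (simp add: sub_l sub_r matrix_mul_assoc)
  show "lie (c *\<^sub>C x) y = c *\<^sub>C lie x y" "lie x (c *\<^sub>C y) = c *\<^sub>C lie x y"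
    by (transfer, simp add: matrix_matrix_mult_def vec_eq_iff right_diff_distrib sum_distrib_left
        mult.assoc mult.left_commute)+
qed (transfer, simp add: vec_eq_iff distrib_left distrib_right mult.assoc)+
end

lift_definition mat_unit :: "'n::finite \<Rightarrow> 'n \<Rightarrow> 'n gl"
  is "\<lambda>i j. \<chi> k l. if k = i \<and> l = j then 1 else 0" .

lemma mat_unit_mult:
  "mat_of_gl (mat_unit i j) ** mat_of_gl (mat_unit k l) =
     (if j = k then mat_of_gl (mat_unit i l) else 0)"
proof -
  let ?U = "\<lambda>i j. mat_of_gl (mat_unit i j)"
  have "(\<Sum>m\<in>UNIV. ?U i j $ r $ m * ?U k l $ m $ s) = (if j = k then ?U i l else 0) $ r $ s" for r s
  proof -
    have "(\<Sum>m\<in>UNIV. ?U i j $ r $ m * ?U k l $ m $ s) =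
        (\<Sum>m\<in>UNIV. if m = j then (if j = k then ?U i l else 0) $ r $ s else 0)"
      by (rule sum.cong) (auto simp: mat_unit.rep_eq)
    also have "\<dots> = (if j = k then ?U i l else 0) $ r $ s"
      by (subst sum.delta) auto
    finally show ?thesis .
  qed
  then show ?thesis
    by (simp only: vec_eq_iff matrix_matrix_mult_def vec_lambda_beta) blast
qed

lemma lie_mat_unit:
  "lie (mat_unit i j) (mat_unit k l) =
     (if j = k then mat_unit i l else 0) - (if i = l then mat_unit k j else 0)"
  by (rule mat_of_gl_inject[THEN iffD1])
     (auto simp: lie_gl.rep_eq minus_gl.rep_eq zero_gl.rep_eq mat_unit_mult)

section \<open>The elements \<open>T\<^sub>k\<close>\<close>

definition E_gl :: "'n::finite \<Rightarrow> 'n \<Rightarrow> 'a::comm_unital_complex_algebra \<Rightarrow> ('n gl, 'a) tensor uea" where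
  "E_gl i j b = uea_of (mat_unit i j \<otimes>\<^sub>C b)"

text \<open>The identification of \<open>\<gg>\<close> with \<open>\<gg> \<otimes> 1\<close> inside \<open>U(\<gg> \<otimes> A)\<close>.\<close>

definition gl_emb :: "'n::finite gl \<Rightarrow> ('n gl, 'a::comm_unital_complex_algebra) tensor uea" where
  "gl_emb x = uea_of (x \<otimes>\<^sub>C 1)"

text \<open>Here \<open>k = length b\<close>.  Positions run from \<open>0\<close> to \<open>k - 1\<close>, and the successor modulo \<open>k\<close> makes
  the last factor \<open>E_gl i\<^sub>k i\<^sub>1 b\<^sub>k\<close>.\<close>

definition T_gl :: "'a::comm_unital_complex_algebra list \<Rightarrow> ('n::finite gl, 'a) tensor uea" where
  "T_gl b = (\<Sum>i\<in>{i :: 'n list. length i = length b}.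
            \<Prod>j\<leftarrow>[0..<length b]. E_gl (i ! j) (i ! (Suc j mod length b)) (b ! j))"

end

theory Submission
  imports Defs
begin

text \<open>The proof reads \<open>T\<^sub>k\<close> as the trace of a matrix product.  Let \<open>\<E>(b)\<close> be the matrix over
  \<open>U(\<gg> \<otimes> A)\<close> with entries \<open>E\<^sub>i\<^sub>j(b)\<close>.  Grouping the summands of \<open>T\<^sub>k\<close> by \<open>i\<^sub>1\<close> shows
  \<open>T\<^sub>k(b\<^sub>1,\<dots>,b\<^sub>k) = tr (\<E>(b\<^sub>1) \<cdots> \<E>(b\<^sub>k))\<close> (\<open>T_gl_eq_trace\<close>).

  Call a matrix \<open>F\<close> over \<open>U(\<gg> \<otimes> A)\<close> covariant if its entries behave under bracketing with
  \<open>\<gg> \<otimes> 1\<close> as the matrix units do, that is, if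
  \<open>[F\<^sub>i\<^sub>j, E\<^sub>p\<^sub>q(1)] = \<delta>\<^sub>j\<^sub>p F\<^sub>i\<^sub>q - \<delta>\<^sub>i\<^sub>q F\<^sub>p\<^sub>j\<close>.
  Since \<open>b \<cdot> 1 = b\<close>, the matrix \<open>\<E>(b)\<close> is covariant.  A bracket with a fixed element is a
  derivation, and this makes covariance pass to products: in \<open>\<Sum>\<^sub>m [F\<^sub>i\<^sub>m G\<^sub>m\<^sub>j, E\<^sub>p\<^sub>q(1)]\<close> the two terms
  in which the inner index \<open>m\<close> is hit are \<open>F\<^sub>i\<^sub>q G\<^sub>p\<^sub>j\<close> with opposite signs
  (\<open>covariant_mat_prod\<close>).  The trace of a covariant matrix commutes with every \<open>E\<^sub>p\<^sub>q(1)\<close>, because the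
  brackets of its diagonal entries add up to \<open>F\<^sub>p\<^sub>q - F\<^sub>p\<^sub>q\<close>.  As the matrix units span \<open>\<gg>\<close>, linearity
  gives the result for all of \<open>\<gg>\<close>.\<close>

section \<open>Sums over closed index walks as traces\<close>

fun mat_prod_entry ::
    "('n::finite \<Rightarrow> 'n \<Rightarrow> 'b \<Rightarrow> 'r::semiring_1) \<Rightarrow> 'b list \<Rightarrow> 'n \<Rightarrow> 'n \<Rightarrow> 'r" where
  "mat_prod_entry F [] i l = of_bool (i = l)"
| "mat_prod_entry F (b # bs) i l = (\<Sum>m\<in>UNIV. F i m b * mat_prod_entry F bs m l)"

lemma sum_lists_Suc:
  fixes g :: "'n::finite list \<Rightarrow> 'r::comm_monoid_add"
  shows "(\<Sum>is\<in>{is. length is = Suc n}. g is) =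
    (\<Sum>m\<in>UNIV. \<Sum>js\<in>{js. length js = n}. g (m # js))"
proof -
  have "(\<Sum>is\<in>{is. length is = Suc n}. g is) =
      (\<Sum>(m, js)\<in>UNIV \<times> {js. length js = n}. g (m # js))"
    by (rule sum.reindex_bij_witness[of _ "\<lambda>(m, js). m # js" "\<lambda>is. (hd is, tl is)"])
       (auto simp: length_Suc_conv)
  then show ?thesis
    by (simp add: sum.cartesian_product)
qed

text \<open>Expanding all the matrix products in an entry of \<open>\<E>(b\<^sub>1) \<cdots> \<E>(b\<^sub>n\<^sub>+\<^sub>1)\<close> gives one summand for
  each choice \<open>js\<close> of the \<open>n\<close> inner indices between the row \<open>i\<close> and the column \<open>l\<close>.\<close>

lemma sum_walks_eq_mat_prod_entry:
  fixes F :: "'n::finite \<Rightarrow> 'n \<Rightarrow> 'b \<Rightarrow> 'r::semiring_1"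
  assumes "length bs = Suc n"
  shows "(\<Sum>js\<in>{js. length js = n}. \<Prod>j\<leftarrow>[0..<Suc n].
      F ((i # js @ [l]) ! j) ((i # js @ [l]) ! Suc j) (bs ! j)) = mat_prod_entry F bs i l"
  using assms
proof (induction n arbitrary: i bs)
  case 0
  then obtain b where "bs = [b]"
    by (auto simp: length_Suc_conv)
  then show ?case
    by (simp add: of_bool_def if_distrib sum.delta cong: if_cong)
next
  case (Suc n)
  then obtain b bs' where bs: "bs = b # bs'" and len: "length bs' = Suc n"
    by (auto simp: length_Suc_conv)
  let ?w = "\<lambda>m js. \<Prod>j\<leftarrow>[0..<Suc n].
    F ((m # js @ [l]) ! j) ((m # js @ [l]) ! Suc j) (bs' ! j)"
  have split: "(\<Prod>j\<leftarrow>[0..<Suc (Suc n)].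
      F ((i # (m # js) @ [l]) ! j) ((i # (m # js) @ [l]) ! Suc j) (bs ! j)) = F i m b * ?w m js"
    for m js
    by (subst map_upt_Suc) (simp add: bs del: upt_Suc)
  show ?case
    by (simp only: sum_lists_Suc split sum_distrib_left[symmetric] Suc.IH[OF len])
       (simp add: bs)
qed

lemma T_gl_eq_trace:
  fixes b :: "'a::comm_unital_complex_algebra list"
  assumes "b \<noteq> []"
  shows "(T_gl b :: ('n::finite gl, 'a) tensor uea) = (\<Sum>i\<in>UNIV. mat_prod_entry E_gl b i i)"
proof -
  obtain n where n: "length b = Suc n"
    using assms by (cases b) auto
  \<comment> \<open>Closing the walk \<open>i # js\<close> by repeating \<open>i\<close> at its end replaces the cyclic successor.\<close>
  have cyc: "(i # js) ! (Suc j mod Suc n) = (i # js @ [i]) ! Suc j"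
    and init: "(i # js) ! j = (i # js @ [i]) ! j"
    if "length js = n" "j < Suc n" for i :: 'n and js j
    using that by (cases "j = n"; auto simp: nth_append nth_Cons split: nat.split)+
  have "(T_gl b :: ('n gl, 'a) tensor uea) =
      (\<Sum>i\<in>UNIV. \<Sum>js\<in>{js. length js = n}. \<Prod>j\<leftarrow>[0..<Suc n].
        E_gl ((i # js) ! j) ((i # js) ! (Suc j mod Suc n)) (b ! j))"
    by (simp only: T_gl_def n sum_lists_Suc)
  also have "\<dots> = (\<Sum>i\<in>UNIV. \<Sum>js\<in>{js. length js = n}. \<Prod>j\<leftarrow>[0..<Suc n].
        E_gl ((i # js @ [i]) ! j) ((i # js @ [i]) ! Suc j) (b ! j))"
    by (intro sum.cong refl arg_cong[where f = prod_list] map_cong arg_cong2[where f = "\<lambda>r s. E_gl r s _"])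
       (simp_all only: mem_Collect_eq set_upt atLeastLessThan_iff cyc init)
  also have "\<dots> = (\<Sum>i\<in>UNIV. mat_prod_entry E_gl b i i)"
    by (simp only: sum_walks_eq_mat_prod_entry[OF n])
  finally show ?thesis .
qed

section \<open>Covariant matrices\<close>

text \<open>In the application \<open>e p q\<close> is \<open>E\<^sub>p\<^sub>q(1)\<close>.  Covariance is stated for an arbitrary matrix \<open>e\<close> over a
  ring because its behaviour under products and traces is a matter of the Leibniz rule alone.\<close>

definition covariant :: "('n \<Rightarrow> 'n \<Rightarrow> 'r::ring_1) \<Rightarrow> ('n \<Rightarrow> 'n \<Rightarrow> 'r) \<Rightarrow> bool" where
  "covariant e F \<longleftrightarrow> (\<forall>i j p q. F i j * e p q - e p q * F i j =
     of_bool (j = p) * F i q - of_bool (i = q) * F p j)"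

lemma covariant_identity: "covariant e (\<lambda>i j. of_bool (i = j))"
  by (auto simp: covariant_def)

text \<open>By the Leibniz rule the bracket of \<open>F\<^sub>i\<^sub>m G\<^sub>m\<^sub>j\<close> has four terms; after summation over \<open>m\<close> the
  two with a Kronecker delta in \<open>m\<close> cancel and the other two are the ones wanted.\<close>

lemma covariant_mat_prod:
  fixes e F G :: "'n::finite \<Rightarrow> 'n \<Rightarrow> 'r::ring_1"
  assumes F: "covariant e F" and G: "covariant e G"
  shows "covariant e (\<lambda>i j. \<Sum>m\<in>UNIV. F i m * G m j)"
  unfolding covariant_def
proof (intro allI)
  fix i j p q
  have leibniz: "F i m * G m j * e p q - e p q * (F i m * G m j) =
      F i m * (G m j * e p q - e p q * G m j) + (F i m * e p q - e p q * F i m) * G m j" for m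
    by (simp add: algebra_simps)
  have "(\<Sum>m\<in>UNIV. F i m * G m j) * e p q - e p q * (\<Sum>m\<in>UNIV. F i m * G m j) =
      (\<Sum>m\<in>UNIV. F i m * (G m j * e p q - e p q * G m j) +
        (F i m * e p q - e p q * F i m) * G m j)"
    by (simp only: leibniz[symmetric] sum_distrib_left sum_distrib_right sum_subtractf)
  also have "\<dots> = (\<Sum>m\<in>UNIV. F i m * (of_bool (j = p) * G m q - of_bool (m = q) * G p j) +
        (of_bool (m = p) * F i q - of_bool (i = q) * F p m) * G m j)"
    using F G by (simp only: covariant_def)
  also have "\<dots> = (\<Sum>m\<in>UNIV. of_bool (j = p) * (F i m * G m q) - of_bool (i = q) * (F p m * G m j))
      + (\<Sum>m\<in>UNIV. (if m = p then F i q * G m j else 0) - (if m = q then F i m * G p j else 0))"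
    by (subst sum.distrib[symmetric], rule sum.cong) (auto simp: algebra_simps)
  also have "\<dots> = of_bool (j = p) * (\<Sum>m\<in>UNIV. F i m * G m q) -
      of_bool (i = q) * (\<Sum>m\<in>UNIV. F p m * G m j)"
    by (simp add: sum_subtractf sum_distrib_left)
  finally show "(\<Sum>m\<in>UNIV. F i m * G m j) * e p q - e p q * (\<Sum>m\<in>UNIV. F i m * G m j) =
    of_bool (j = p) * (\<Sum>m\<in>UNIV. F i m * G m q) - of_bool (i = q) * (\<Sum>m\<in>UNIV. F p m * G m j)" .
qed

lemma covariant_mat_prod_entry:
  assumes "\<And>b. covariant e (\<lambda>i j. F i j b)"
  shows "covariant e (mat_prod_entry F bs)"
proof (induction bs)
  case Nil
  then show ?case
    using covariant_identity[of e] by (simp add: covariant_def)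
next
  case (Cons b bs)
  then show ?case
    using covariant_mat_prod[OF assms[of b], of "mat_prod_entry F bs"] by (simp add: covariant_def)
qed

lemma covariant_trace_commutes:
  fixes e F :: "'n::finite \<Rightarrow> 'n \<Rightarrow> 'r::ring_1"
  assumes "covariant e F"
  shows "(\<Sum>i\<in>UNIV. F i i) * e p q = e p q * (\<Sum>i\<in>UNIV. F i i)"
proof -
  have "(\<Sum>i\<in>UNIV. F i i) * e p q - e p q * (\<Sum>i\<in>UNIV. F i i) =
      (\<Sum>i\<in>UNIV. of_bool (i = p) * F i q - of_bool (i = q) * F p i)"
    using assms
    by (simp only: covariant_def sum_distrib_left sum_distrib_right sum_subtractf[symmetric])
  also have "\<dots> = (\<Sum>i\<in>UNIV. if i = p then F i q else 0) - (\<Sum>i\<in>UNIV. if i = q then F p i else 0)"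
    by (subst sum_subtractf[symmetric], rule sum.cong) auto
  also have "\<dots> = 0"
    by simp
  finally show ?thesis
    by simp
qed

section \<open>The matrix units in the enveloping algebra\<close>

lemma clinear_uea_of_pure_tensor: "clinear (\<lambda>x. uea_of (x \<otimes>\<^sub>C a))"
  by (rule clinearI)
     (simp_all add: pure_tensor_add_left pure_tensor_scaleC_left uea_of_add uea_of_scaleC)

lemma clinear_gl_emb: "clinear gl_emb"
  unfolding gl_emb_def by (rule clinear_uea_of_pure_tensor)

lemma covariant_E_gl:
  fixes b :: "'a::comm_unital_complex_algebra"
  shows "covariant (\<lambda>p q. gl_emb (mat_unit p q)) (\<lambda>i j :: 'n::finite. E_gl i j b)"
  unfolding covariant_def
proof (intro allI)
  fix i j p q :: 'n
  note lin = clinear_uea_of_pure_tensor[of b]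
  have "E_gl i j b * gl_emb (mat_unit p q) - gl_emb (mat_unit p q) * E_gl i j b =
      uea_of (lie (mat_unit i j) (mat_unit p q) \<otimes>\<^sub>C b)"
    by (simp add: E_gl_def gl_emb_def uea_of_lie lie_pure_tensor)
  also have "\<dots> = of_bool (j = p) * E_gl i q b - of_bool (i = q) * E_gl p j b"
    using clinear_zero[OF lin] by (auto simp: lie_mat_unit clinear_diff[OF lin] E_gl_def)
  finally show "E_gl i j b * gl_emb (mat_unit p q) - gl_emb (mat_unit p q) * E_gl i j b =
    of_bool (j = p) * E_gl i q b - of_bool (i = q) * E_gl p j b" .
qed

lemma gl_eq_sum_mat_unit:
  "x = (\<Sum>p\<in>UNIV. \<Sum>q\<in>UNIV. (mat_of_gl x $ p $ q) *\<^sub>C mat_unit p q)"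
proof -
  have sum1: "mat_of_gl (sum f S) = (\<Sum>s\<in>S. mat_of_gl (f s))"
    for f :: "'a \<Rightarrow> 'a gl" and S
    by (induction S rule: infinite_finite_induct) (simp_all add: zero_gl.rep_eq plus_gl.rep_eq)
  have "(\<Sum>p\<in>UNIV. \<Sum>q\<in>UNIV. mat_of_gl x $ p $ q * (if r = p \<and> s = q then 1 else 0)) =
      (\<Sum>p\<in>UNIV. if p = r then mat_of_gl x $ p $ s else 0)" for r s
    by (rule sum.cong) (auto simp: if_distrib sum.delta' cong: if_cong)
  then show ?thesis
    by (simp add: mat_of_gl_inject[symmetric] sum1 vec_eq_iff scaleC_gl.rep_eq mat_unit.rep_eq)
qed

theorem proposition4p4:
  fixes k :: nat
    and b :: "'a::comm_unital_complex_algebra list"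
    and x :: "'n::finite gl"
  assumes "k \<ge> 1" and "length b = k"
  shows "(T_gl b :: ('n gl, 'a) tensor uea) * gl_emb x - gl_emb x * T_gl b = 0"
proof -
  let ?T = "T_gl b :: ('n gl, 'a) tensor uea"
  have "b \<noteq> []"
    using assms by auto
  note trace = T_gl_eq_trace[OF this]
  have unit: "?T * gl_emb (mat_unit p q) = gl_emb (mat_unit p q) * ?T" for p q
    using covariant_trace_commutes[OF covariant_mat_prod_entry[of _ E_gl b, OF covariant_E_gl]]
    by (simp only: trace)
  have comm0: "?T * gl_emb 0 = gl_emb 0 * ?T"
    by (simp add: clinear_zero[OF clinear_gl_emb])
  have comm_add: "?T * gl_emb (y + z) = gl_emb (y + z) * ?T"
    if "?T * gl_emb y = gl_emb y * ?T" "?T * gl_emb z = gl_emb z * ?T" for y z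
    using that by (simp add: clinear_add[OF clinear_gl_emb] distrib_left distrib_right)
  have comm_sum: "?T * gl_emb (sum f S) = gl_emb (sum f S) * ?T"
    if "\<And>s. ?T * gl_emb (f s) = gl_emb (f s) * ?T" for f :: "'n \<Rightarrow> 'n gl" and S
    by (induction S rule: infinite_finite_induct) (simp_all add: comm0 comm_add that)
  have scaled: "?T * gl_emb (c *\<^sub>C mat_unit p q) = gl_emb (c *\<^sub>C mat_unit p q) * ?T" for c p q
    by (simp add: clinear_scaleC[OF clinear_gl_emb] uea_scaleC_mult_left uea_scaleC_mult_right unit)
  have "?T * gl_emb x = gl_emb x * ?T"
    by (subst (1 2) gl_eq_sum_mat_unit[of x]) (intro comm_sum scaled)
  then show ?thesis
    by simp
qed

end
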